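(* For every $\tau\in\mathbb{H}^2$, $$\frac{\theta'[1,\frac15]}{\theta[1,\frac15]}=\theta'[1,1]\,\frac{\theta^5[1,\frac15]-3\,\theta^5[1,\frac35]}{10\,\theta^3[1,\frac15]\,\theta^3[1,\frac35]},\qquad \frac{\theta'[1,\frac35]}{\theta[1,\frac35]}=\theta'[1,1]\,\frac{3\,\theta^5[1,\frac15]+\theta^5[1,\frac35]}{10\,\theta^3[1,\frac15]\,\theta^3[1,\frac35]}.$$
   Context: $\mathbb{H}^2=\{\tau\in\mathbb{C} : \Im\tau>0\}$ is the upper half plane. For $\epsilon,\epsilon'\in\mathbb{R}$, $\zeta\in\mathbb{C}$, $\tau\in\mathbb{H}^2$, the theta function with characteristics is $$\theta[\epsilon,\epsilon'](\zeta,\tau)=\sum_{n\in\mathbb{Z}}\exp\left(2\pi i\left[\tfrac12\left(n+\tfrac{\epsilon}{2}\right)^2\tau+\left(n+\tfrac{\epsilon}{2}\right)\left(\zeta+\tfrac{\epsilon'}{2}\right)\right]\right).$$ Write $\theta[\epsilon,\epsilon']=\theta[\epsilon,\epsilon'](0,\tau)$ and $\theta'[\epsilon,\epsilon']=\frac{\partial}{\partial\zeta}\theta[\epsilon,\epsilon'](\zeta,\tau)\big|_{\zeta=0}$; $\theta^k[\epsilon,\epsilon']$ means the $k$-th power of $\theta[\epsilon,\epsilon']$. *)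

theory Defs
  imports "HOL-Analysis.Analysis"
begin

text \<open>
  The theta function with real characteristics. For \<open>Im \<tau> > 0\<close> the series converges
  absolutely, so the unordered sum \<^const>\<open>infsum\<close> over all integers is the usual two-sided series.
\<close>

definition theta :: "real \<Rightarrow> real \<Rightarrow> complex \<Rightarrow> complex \<Rightarrow> complex" where
  "theta \<epsilon> \<epsilon>' \<zeta> \<tau> =
     (\<Sum>\<^sub>\<infinity>n\<in>(UNIV :: int set).
        exp (2 * of_real pi * \<i> *
              (1/2 * (of_int n + of_real \<epsilon> / 2)^2 * \<tau>
               + (of_int n + of_real \<epsilon> / 2) * (\<zeta> + of_real \<epsilon>' / 2))))"

definition theta_const :: "real \<Rightarrow> real \<Rightarrow> complex \<Rightarrow> complex" where
  "theta_const \<epsilon> \<epsilon>' \<tau> = theta \<epsilon> \<epsilon>' 0 \<tau>"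

definition theta_deriv :: "real \<Rightarrow> real \<Rightarrow> complex \<Rightarrow> complex" where
  "theta_deriv \<epsilon> \<epsilon>' \<tau> = deriv (\<lambda>\<zeta>. theta \<epsilon> \<epsilon>' \<zeta> \<tau>) 0"

end

theory Submission
  imports Defs "HOL-Complex_Analysis.Complex_Analysis"
begin

text \<open>
  Write \<open>T x = theta 1 1 x \<tau>\<close>, an odd entire function with \<open>T (x + 1) = - T x\<close>. A change of the lower
  characteristic \<open>\<epsilon>'\<close> is a translation of the argument, so the constants with characteristics
  \<open>[1, 1/5]\<close> and \<open>[1, 3/5]\<close> are \<open>- T (2/5)\<close> and \<open>- T (1/5)\<close>, and the claim concerns the logarithmic
  derivative \<open>L = T' / T\<close> at \<open>1/5\<close> and \<open>2/5\<close>.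

  Rearranging the double series gives \<open>T (x + y) T (x - y)\<close> as a 2-by-2 determinant
  (\<open>theta11_product\<close>). The Pluecker relation between such determinants is the three-term relation
  of Weierstrass, and its derivative yields (\<open>theta11_triple\<close>)
  \<open>3 L u - L (3 u) = T' 0 * T (2 u) ^ 3 / (T u ^ 3 * T (3 u))\<close>.
  For \<open>u = 1/5\<close> and \<open>u = 2/5\<close> the arguments \<open>2 u\<close> and \<open>3 u\<close> reduce to fifths again, and with
  \<open>a = T (1/5)\<close>, \<open>b = T (2/5)\<close> this becomes the linear system
  \<open>3 L (1/5) + L (2/5) = T' 0 * b^2 / a^3\<close>, \<open>3 L (2/5) - L (1/5) = - T' 0 * a^2 / b^3\<close>,
  whose solution is the theorem.

  The quotients are meaningful because \<open>a\<close> and \<open>b\<close> are nonzero. A zero of \<open>T\<close> at a real torsion point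
  is excluded by \<open>theta11_torsion_nonzero\<close>: such a zero would make the quotient of \<open>T\<close> and its translate
  constant, against the quasi-periodicity of \<open>T\<close> in the direction \<open>\<tau>\<close>. This rests on the product formula
  again and on the fact that \<open>T\<close> does not vanish identically.
\<close>

section \<open>Convergence and holomorphy of the theta series\<close>

definition theta_term :: "real \<Rightarrow> real \<Rightarrow> complex \<Rightarrow> complex \<Rightarrow> int \<Rightarrow> complex" where
  "theta_term \<epsilon> \<epsilon>' \<tau> \<zeta> n =
     exp (2 * of_real pi * \<i> *
           (1/2 * (of_int n + of_real \<epsilon> / 2)^2 * \<tau>
            + (of_int n + of_real \<epsilon> / 2) * (\<zeta> + of_real \<epsilon>' / 2)))"

lemma theta_eq_infsum: "theta \<epsilon> \<epsilon>' \<zeta> \<tau> = (\<Sum>\<^sub>\<infinity>n. theta_term \<epsilon> \<epsilon>' \<tau> \<zeta> n)"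
  by (simp add: theta_def theta_term_def)

lemma norm_theta_term:
  "norm (theta_term \<epsilon> \<epsilon>' \<tau> \<zeta> n) =
     exp (- pi * Im \<tau> * (of_int n + \<epsilon>/2)^2 - 2 * pi * (of_int n + \<epsilon>/2) * Im \<zeta>)"
proof -
  define a :: real where "a = of_int n + \<epsilon>/2"
  have a: "of_int n + of_real \<epsilon> / 2 = complex_of_real a" by (simp add: a_def)
  show ?thesis
    unfolding theta_term_def a
    unfolding norm_exp_eq_Re a_def [symmetric]
    by (simp add: algebra_simps flip: of_real_power)
qed

lemma summable_exp_minus_abs_int: "(\<lambda>n::int. exp (- \<bar>real_of_int n\<bar>)) summable_on UNIV"
proof -
  have "summable (\<lambda>n. exp (-1::real) ^ n)"
    by (rule summable_geometric) simp
  hence geo: "(\<lambda>n::nat. exp (- real n)) summable_on UNIV"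
    by (intro summable_nonneg_imp_summable_on) (auto simp: exp_of_nat_mult [symmetric])
  have "(\<lambda>n::int. exp (- \<bar>real_of_int n\<bar>)) summable_on range int"
    by (subst summable_on_reindex) (use geo in \<open>auto simp: o_def\<close>)
  moreover have "(\<lambda>n::int. exp (- \<bar>real_of_int n\<bar>)) summable_on range (\<lambda>n. - int n)"
    by (subst summable_on_reindex) (use geo in \<open>auto simp: o_def inj_on_def\<close>)
  ultimately have "(\<lambda>n::int. exp (- \<bar>real_of_int n\<bar>)) summable_on (range int \<union> range (\<lambda>n. - int n))"
    by (rule summable_on_union)
  also have "range int \<union> range (\<lambda>n. - int n) = UNIV"
    by (auto simp: image_iff) (metis int_cases2)
  finally show ?thesis .
qed

text \<open>
  Completing the square in the Gaussian exponent beats any linear growth. The bound is uniform on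
  horizontal strips because the norm of a term depends on \<open>\<zeta>\<close> only through \<open>Im \<zeta>\<close>; one estimate therefore gives
  absolute summability, holomorphy and termwise integration over real intervals.
\<close>
lemma theta_term_bound:
  assumes "Im \<tau> > 0"
  obtains K where "\<And>\<zeta> n. \<bar>Im \<zeta>\<bar> \<le> R \<Longrightarrow>
    norm (theta_term \<epsilon> \<epsilon>' \<tau> \<zeta> n) \<le> K * exp (- \<bar>real_of_int n\<bar>)"
proof
  fix \<zeta> :: complex and n :: int
  assume R: "\<bar>Im \<zeta>\<bar> \<le> R"
  define a :: real where "a = of_int n + \<epsilon>/2"
  define c b where "c = pi * Im \<tau>" and "b = 2 * pi * R + 1"
  have c: "c > 0" using assms by (simp add: c_def)
  have "0 \<le> (2 * c * \<bar>a\<bar> - b)^2 / (4 * c)" using c by simp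
  also have "\<dots> = c * a^2 - b * \<bar>a\<bar> + b^2 / (4 * c)"
    using c by (simp add: field_simps power2_eq_square)
  finally have sq: "- c * a^2 + 2 * pi * R * \<bar>a\<bar> \<le> b^2 / (4 * c) - \<bar>a\<bar>"
    by (simp add: b_def algebra_simps)
  have "- (a * Im \<zeta>) \<le> \<bar>a\<bar> * R"
    by (metis R abs_ge_minus_self abs_ge_zero abs_mult dual_order.trans mult_left_mono)
  hence "2 * pi * (- (a * Im \<zeta>)) \<le> 2 * pi * (\<bar>a\<bar> * R)"
    by (intro mult_left_mono) auto
  moreover have "\<bar>real_of_int n\<bar> \<le> \<bar>a\<bar> + \<bar>\<epsilon>\<bar> / 2" by (simp add: a_def)
  ultimately have "- c * a^2 - 2 * pi * a * Im \<zeta> \<le> (b^2 / (4 * c) + \<bar>\<epsilon>\<bar> / 2) + - \<bar>real_of_int n\<bar>"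
    using sq by (simp add: algebra_simps)
  hence "norm (theta_term \<epsilon> \<epsilon>' \<tau> \<zeta> n) \<le> exp ((b^2 / (4 * c) + \<bar>\<epsilon>\<bar> / 2) + - \<bar>real_of_int n\<bar>)"
    unfolding norm_theta_term a_def [symmetric] by (simp add: c_def)
  thus "norm (theta_term \<epsilon> \<epsilon>' \<tau> \<zeta> n) \<le>
          exp ((2 * pi * R + 1)^2 / (4 * (pi * Im \<tau>)) + \<bar>\<epsilon>\<bar> / 2) * exp (- \<bar>real_of_int n\<bar>)"
    by (simp add: exp_add [symmetric] b_def c_def)
qed

lemma theta_term_abs_summable:
  assumes "Im \<tau> > 0"
  shows "(\<lambda>n. norm (theta_term \<epsilon> \<epsilon>' \<tau> \<zeta> n)) summable_on UNIV"
proof -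
  obtain K where K: "\<And>\<zeta>' n. \<bar>Im \<zeta>'\<bar> \<le> \<bar>Im \<zeta>\<bar> \<Longrightarrow>
      norm (theta_term \<epsilon> \<epsilon>' \<tau> \<zeta>' n) \<le> K * exp (- \<bar>real_of_int n\<bar>)"
    using theta_term_bound[OF assms] by blast
  show ?thesis
    by (rule summable_on_comparison_test
          [OF summable_on_cmult_right[OF summable_exp_minus_abs_int, of K]])
       (use K in auto)
qed

lemma uniform_limit_theta:
  assumes "Im \<tau> > 0"
  shows "uniform_limit {\<zeta>. \<bar>Im \<zeta>\<bar> \<le> R} (\<lambda>N \<zeta>. \<Sum>n\<in>N. theta_term \<epsilon> \<epsilon>' \<tau> \<zeta> n)
           (\<lambda>\<zeta>. theta \<epsilon> \<epsilon>' \<zeta> \<tau>) (finite_subsets_at_top UNIV)"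
proof -
  obtain K where K: "\<And>\<zeta> n. \<bar>Im \<zeta>\<bar> \<le> R \<Longrightarrow>
      norm (theta_term \<epsilon> \<epsilon>' \<tau> \<zeta> n) \<le> K * exp (- \<bar>real_of_int n\<bar>)"
    using theta_term_bound[OF assms] by blast
  show ?thesis
    unfolding theta_eq_infsum
    by (rule Weierstrass_m_test_general
          [OF _ summable_on_cmult_right[OF summable_exp_minus_abs_int, of K]])
       (use K in auto)
qed

lemma theta_holomorphic:
  assumes "Im \<tau> > 0"
  shows "(\<lambda>\<zeta>. theta \<epsilon> \<epsilon>' \<zeta> \<tau>) holomorphic_on A"
proof -
  have "(\<lambda>\<zeta>. theta \<epsilon> \<epsilon>' \<zeta> \<tau>) holomorphic_on ball z 1" for z
  proof -
    have "cball z 1 \<subseteq> {\<zeta>. \<bar>Im \<zeta>\<bar> \<le> \<bar>Im z\<bar> + 1}"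
    proof
      fix \<zeta> assume "\<zeta> \<in> cball z 1"
      hence "\<bar>Im (z - \<zeta>)\<bar> \<le> 1"
        using abs_Im_le_cmod[of "z - \<zeta>"] by (simp add: dist_norm)
      thus "\<zeta> \<in> {\<zeta>. \<bar>Im \<zeta>\<bar> \<le> \<bar>Im z\<bar> + 1}" by auto
    qed
    hence lim: "uniform_limit (cball z 1) (\<lambda>N \<zeta>. \<Sum>n\<in>N. theta_term \<epsilon> \<epsilon>' \<tau> \<zeta> n)
                  (\<lambda>\<zeta>. theta \<epsilon> \<epsilon>' \<zeta> \<tau>) (finite_subsets_at_top UNIV)"
      by (rule uniform_limit_on_subset[OF uniform_limit_theta[OF assms]])
    show ?thesis
      by (rule holomorphic_uniform_limit[OF always_eventually lim])
         (auto simp: theta_term_def intro!: continuous_intros holomorphic_intros)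
  qed
  hence "(\<lambda>\<zeta>. theta \<epsilon> \<epsilon>' \<zeta> \<tau>) holomorphic_on (\<Union>z\<in>A. ball z 1)"
    by (intro holomorphic_on_UN_open) auto
  moreover have "A \<subseteq> (\<Union>z\<in>A. ball z 1)"
    by (meson UN_I centre_in_ball subsetI zero_less_one)
  ultimately show ?thesis
    by (rule holomorphic_on_subset)
qed

lemma theta_has_field_derivative:
  assumes "Im \<tau> > 0"
  shows "((\<lambda>\<zeta>. theta \<epsilon> \<epsilon>' \<zeta> \<tau>) has_field_derivative deriv (\<lambda>\<zeta>. theta \<epsilon> \<epsilon>' \<zeta> \<tau>) z) (at z)"
  by (rule holomorphic_derivI[OF theta_holomorphic[OF assms, of _ _ UNIV]]) auto

text \<open>
  Along the real axis the series is, up to the factor \<open>exp (\<pi> \<i> \<epsilon> x)\<close>, a Fourier series with period 1. Its zeroth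
  Fourier coefficient is an exponential and cannot vanish.
\<close>
lemma theta_not_identically_zero:
  assumes "Im \<tau> > 0"
  shows "\<exists>\<zeta>. theta \<epsilon> \<epsilon>' \<zeta> \<tau> \<noteq> 0"
proof (rule ccontr)
  assume "\<not> ?thesis"
  hence zero: "theta \<epsilon> \<epsilon>' \<zeta> \<tau> = 0" for \<zeta> by blast
  define e where "e = (\<lambda>x::real. exp (- (of_real pi * \<i> * of_real \<epsilon> * of_real x)) :: complex)"
  define c where "c = (\<lambda>n. theta_term \<epsilon> \<epsilon>' \<tau> 0 n)"
  have term_e: "theta_term \<epsilon> \<epsilon>' \<tau> (of_real x) n * e x = c n * exp (2 * of_real pi * \<i> * of_int n * of_real x)"
    for x n
    unfolding theta_term_def e_def c_def
    by (simp add: exp_add [symmetric] algebra_simps)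
  have int: "((\<lambda>x. c n * exp (2 * of_real pi * \<i> * of_int n * of_real x))
               has_integral (if n = 0 then c 0 else 0)) {0..1::real}" for n
  proof (cases "n = 0")
    case True
    thus ?thesis using has_integral_const_real[of "c 0" 0 1] by simp
  next
    case False
    define k where "k = 2 * of_real pi * \<i> * of_int n"
    have k: "k \<noteq> 0" using False by (simp add: k_def)
    have "((\<lambda>x. c n * exp (k * of_real x)) has_integral
            (c n * exp (k * of_real 1) / k - c n * exp (k * of_real 0) / k)) {0..1::real}"
      by (rule fundamental_theorem_of_calculus)
         (use k in \<open>auto intro!: derivative_eq_intros has_vector_derivative_real_field\<close>)
    moreover have "exp k = 1"
      unfolding k_def using exp_integer_2pi[of "of_int n"] by (simp add: mult_ac)
    ultimately show ?thesis using False by (simp add: k_def)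
  qed
  have "uniform_limit {0..1} (\<lambda>N x. \<Sum>n\<in>N. theta_term \<epsilon> \<epsilon>' \<tau> (of_real x) n)
           (\<lambda>x. theta \<epsilon> \<epsilon>' (of_real x) \<tau>) (finite_subsets_at_top UNIV)"
    using uniform_limit_theta[OF assms, where R = 0 and \<epsilon> = \<epsilon> and \<epsilon>' = \<epsilon>']
    unfolding uniform_limit_iff
    by (elim all_forward imp_forward) (auto elim!: eventually_mono)
  hence "uniform_limit {0..1} (\<lambda>N x. (\<Sum>n\<in>N. theta_term \<epsilon> \<epsilon>' \<tau> (of_real x) n) * e x)
           (\<lambda>x. theta \<epsilon> \<epsilon>' (of_real x) \<tau> * e x) (finite_subsets_at_top UNIV)"
    by (rule uniform_lim_mult)
       (auto simp: zero e_def norm_exp_eq_Re intro!: uniform_limit_const boundedI[of _ 1])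
  hence lim: "uniform_limit {0..1} (\<lambda>N x. \<Sum>n\<in>N. c n * exp (2 * of_real pi * \<i> * of_int n * of_real x))
           (\<lambda>x. 0) (finite_subsets_at_top UNIV)"
    by (simp add: sum_distrib_right term_e zero)
  obtain I J where I: "\<And>N. ((\<lambda>x. \<Sum>n\<in>N. c n * exp (2 * of_real pi * \<i> * of_int n * of_real x)) has_integral I N) {0..1::real}"
    and J: "((\<lambda>x. 0::complex) has_integral J) {0..1::real}" and IJ: "(I \<longlongrightarrow> J) (finite_subsets_at_top UNIV)"
    by (rule uniform_limit_integral[OF lim]) (auto intro!: continuous_intros)
  have "J = 0" using J by simp
  have "I N = c 0" if N: "finite N" "0 \<in> N" for N
  proof -
    have "((\<lambda>x. \<Sum>n\<in>N. c n * exp (2 * of_real pi * \<i> * of_int n * of_real x)) has_integral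
             (\<Sum>n\<in>N. if n = 0 then c 0 else 0)) {0..1::real}"
      by (intro has_integral_sum int N)
    thus ?thesis using I[of N] N by (auto dest: has_integral_unique)
  qed
  hence "eventually (\<lambda>N. I N = c 0) (finite_subsets_at_top UNIV)"
    by (auto simp: eventually_finite_subsets_at_top intro!: exI[of _ "{0}"])
  hence "(I \<longlongrightarrow> c 0) (finite_subsets_at_top UNIV)"
    by (rule tendsto_eventually)
  hence "c 0 = 0"
    using IJ \<open>J = 0\<close> tendsto_unique[OF finite_subsets_at_top_neq_bot] by blast
  thus False by (simp add: c_def theta_term_def)
qed

section \<open>Quasi-periodicity and parity\<close>

lemma exp_eqI: "a = b + (2 * of_int k) * (of_real pi * \<i>) \<Longrightarrow> exp a = exp b"
  by (auto simp: exp_eq mult_ac)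

lemma exp_eq_minusI: "a = b + (2 * of_int k + 1) * (of_real pi * \<i>) \<Longrightarrow> exp a = - exp b"
  using exp_eqI[of a "b + of_real pi * \<i>" k] by (simp add: exp_add algebra_simps)

lemma theta_add_1:
  "theta \<epsilon> \<epsilon>' (\<zeta> + 1) \<tau> = exp (of_real pi * \<i> * of_real \<epsilon>) * theta \<epsilon> \<epsilon>' \<zeta> \<tau>"
proof -
  have "theta_term \<epsilon> \<epsilon>' \<tau> (\<zeta> + 1) n = exp (of_real pi * \<i> * of_real \<epsilon>) * theta_term \<epsilon> \<epsilon>' \<tau> \<zeta> n" for n
    unfolding theta_term_def exp_add [symmetric]
    by (rule exp_eqI[of _ _ n]) (simp add: field_simps)
  thus ?thesis
    by (simp add: theta_eq_infsum infsum_cmult_right')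
qed

lemma theta_add_period:
  "theta \<epsilon> \<epsilon>' (\<zeta> + \<tau>) \<tau> =
     exp (- (of_real pi * \<i> * (\<tau> + 2 * \<zeta> + of_real \<epsilon>'))) * theta \<epsilon> \<epsilon>' \<zeta> \<tau>"
proof -
  have "theta_term \<epsilon> \<epsilon>' \<tau> (\<zeta> + \<tau>) n =
          exp (- (of_real pi * \<i> * (\<tau> + 2 * \<zeta> + of_real \<epsilon>'))) * theta_term \<epsilon> \<epsilon>' \<tau> \<zeta> (n + 1)" for n
    unfolding theta_term_def by (simp add: exp_add [symmetric] field_simps power2_eq_square)
  moreover have "bij (\<lambda>n::int. n + 1)"
    by (rule bij_betw_byWitness[where f' = "\<lambda>n. n - 1"]) auto
  ultimately show ?thesis
    using infsum_reindex_bij_betw[of "\<lambda>n::int. n + 1" UNIV UNIV "theta_term \<epsilon> \<epsilon>' \<tau> \<zeta>"]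
    by (simp add: theta_eq_infsum infsum_cmult_right')
qed

lemma theta11_minus: "theta 1 1 (-\<zeta>) \<tau> = - theta 1 1 \<zeta> \<tau>"
proof -
  have "theta_term 1 1 \<tau> (-\<zeta>) n = - theta_term 1 1 \<tau> \<zeta> (-1 - n)" for n
    unfolding theta_term_def
    by (rule exp_eq_minusI[of _ _ n]) (simp add: field_simps power2_eq_square)
  moreover have "bij (\<lambda>n::int. -1 - n)"
    by (rule bij_betw_byWitness[where f' = "\<lambda>n. -1 - n"]) auto
  ultimately show ?thesis
    using infsum_reindex_bij_betw[of "\<lambda>n::int. -1 - n" UNIV UNIV "theta_term 1 1 \<tau> \<zeta>"]
    by (simp add: theta_eq_infsum infsum_uminus)
qed

lemma theta11_0: "theta 1 1 0 \<tau> = 0"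
  using theta11_minus[of 0 \<tau>] by simp

lemma theta11_add_1: "theta 1 1 (\<zeta> + 1) \<tau> = - theta 1 1 \<zeta> \<tau>"
  by (simp add: theta_add_1)

lemma theta11_add_int_squared: "theta 1 1 (\<zeta> + of_int m) \<tau> ^ 2 = theta 1 1 \<zeta> \<tau> ^ 2"
proof (induction m rule: int_induct[where k = 0])
  case (step1 i)
  have "theta 1 1 (\<zeta> + of_int i + 1) \<tau> ^ 2 = theta 1 1 (\<zeta> + of_int i) \<tau> ^ 2"
    by (simp add: theta11_add_1)
  thus ?case using step1 by (simp add: add_ac)
next
  case (step2 i)
  have "theta 1 1 (\<zeta> + of_int (i - 1) + 1) \<tau> ^ 2 = theta 1 1 (\<zeta> + of_int (i - 1)) \<tau> ^ 2"
    by (simp only: theta11_add_1) simp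
  thus ?case using step2 by simp
qed auto

section \<open>The product formula and the three-term relation\<close>

lemma infsum_mult_infsum:
  fixes f :: "'a \<Rightarrow> complex" and g :: "'b \<Rightarrow> complex"
  assumes "(\<lambda>x. norm (f x)) summable_on A" "(\<lambda>y. norm (g y)) summable_on B"
  shows "(\<lambda>(x, y). f x * g y) summable_on (A \<times> B)"
    and "infsum f A * infsum g B = (\<Sum>\<^sub>\<infinity>(x, y)\<in>A \<times> B. f x * g y)"
proof -
  have "(\<lambda>z. norm (case z of (x, y) \<Rightarrow> f x * g y)) summable_on (A \<times> B)"
    unfolding Infinite_Sum.abs_summable_on_Sigma_iff using assms
    by (auto simp: norm_mult infsum_cmult_right' abs_mult infsum_nonneg
             intro!: summable_on_cmult_right summable_on_cmult_left)
  thus *: "(\<lambda>(x, y). f x * g y) summable_on (A \<times> B)"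
    by (rule abs_summable_summable)
  show "infsum f A * infsum g B = (\<Sum>\<^sub>\<infinity>(x, y)\<in>A \<times> B. f x * g y)"
    using infsum_Sigma'_banach[OF *] by (simp add: infsum_cmult_left' infsum_cmult_right')
qed

text \<open>
  The product is a sum of exponentials over pairs \<open>(m, n)\<close>. Passing from the half-integers \<open>m + 1/2\<close>, \<open>n + 1/2\<close>
  to their sum \<open>r\<close> and difference \<open>s\<close> diagonalises the quadratic form and separates \<open>x\<close> from \<open>y\<close>. Since \<open>r\<close>
  and \<open>s\<close> have opposite parity, two families of terms remain, namely \<open>r\<close> even and \<open>r\<close> odd; the
  characteristic \<open>\<epsilon>' = 1\<close> contributes the factor \<open>(-1)\<^sup>r\<close>, hence the minus sign.
\<close>
lemma theta11_product:
  assumes "Im \<tau> > 0"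
  shows "theta 1 1 (x + y) \<tau> * theta 1 1 (x - y) \<tau> =
           theta 0 0 (2 * x) (2 * \<tau>) * theta 1 0 (2 * y) (2 * \<tau>)
         - theta 1 0 (2 * x) (2 * \<tau>) * theta 0 0 (2 * y) (2 * \<tau>)"
proof -
  define h where "h = (\<lambda>(m, n). theta_term 1 1 \<tau> (x + y) m * theta_term 1 1 \<tau> (x - y) n)"
  define odds evens where "odds = {(m, n::int). odd (m + n)}" and "evens = {(m, n::int). even (m + n)}"
  have \<tau>2: "Im (2 * \<tau>) > 0" using assms by simp
  note abs_summable = theta_term_abs_summable[OF assms] theta_term_abs_summable[OF \<tau>2]
  have h: "h summable_on UNIV"
    and prod: "theta 1 1 (x + y) \<tau> * theta 1 1 (x - y) \<tau> = infsum h UNIV"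
    using infsum_mult_infsum[OF abs_summable(1,1), of 1 1 "x + y" 1 1 "x - y"]
    by (simp_all add: h_def theta_eq_infsum)
  \<comment> \<open>As \<open>r = m + n + 1\<close>, the terms with \<open>r = 2p\<close> and \<open>s = m - n = 2q + 1\<close> are those with \<open>m + n\<close>
    odd, and the terms with \<open>r = 2p + 1\<close> and \<open>s = 2q\<close> those with \<open>m + n\<close> even.\<close>
  have "infsum h UNIV = infsum h (odds \<union> evens)"
    by (rule arg_cong[where f = "infsum h"]) (auto simp: odds_def evens_def)
  also have "\<dots> = infsum h odds + infsum h evens"
    by (rule infsum_Un_disjoint) (auto intro: summable_on_subset_banach[OF h] simp: odds_def evens_def)
  also have "infsum h odds =
      (\<Sum>\<^sub>\<infinity>(p, q). theta_term 0 0 (2 * \<tau>) (2 * x) p * theta_term 1 0 (2 * \<tau>) (2 * y) q)"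
  proof (rule infsum_reindex_bij_witness[where
        i = "\<lambda>(p, q). (p + q, p - q - 1)" and j = "\<lambda>(m, n). ((m + n + 1) div 2, (m - n - 1) div 2)"])
    fix a assume "a \<in> odds"
    then obtain m n where a: "a = (m, n)" and "odd (m + n)"
      by (auto simp: odds_def)
    then obtain k where k: "m + n = 2 * k + 1" by (elim oddE)
    hence n: "n = 2 * k + 1 - m" by simp
    have j: "(m + n + 1) div 2 = k + 1" "(m - n - 1) div 2 = m - k - 1"
      unfolding n by simp_all
    show "(\<lambda>(p, q). (p + q, p - q - 1)) ((\<lambda>(m, n). ((m + n + 1) div 2, (m - n - 1) div 2)) a) = a"
      by (simp add: a j) (simp add: n)
    have "theta_term 0 0 (2 * \<tau>) (2 * x) (k + 1) * theta_term 1 0 (2 * \<tau>) (2 * y) (m - k - 1) =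
          theta_term 1 1 \<tau> (x + y) m * theta_term 1 1 \<tau> (x - y) (2 * k + 1 - m)"
      unfolding theta_term_def exp_add [symmetric]
      by (rule exp_eqI[of _ _ "- (k + 1)"]) (simp add: field_simps power2_eq_square)
    thus "(\<lambda>(p, q). theta_term 0 0 (2 * \<tau>) (2 * x) p * theta_term 1 0 (2 * \<tau>) (2 * y) q)
        ((\<lambda>(m, n). ((m + n + 1) div 2, (m - n - 1) div 2)) a) = h a"
      by (simp add: a j h_def) (simp add: n)
  qed (auto simp: odds_def)
  also have "\<dots> = theta 0 0 (2 * x) (2 * \<tau>) * theta 1 0 (2 * y) (2 * \<tau>)"
    using infsum_mult_infsum(2)[OF abs_summable(2,2), of 0 0 "2 * x" 1 0 "2 * y"]
    by (simp add: theta_eq_infsum)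
  also have "infsum h evens =
      (\<Sum>\<^sub>\<infinity>(p, q). - (theta_term 1 0 (2 * \<tau>) (2 * x) p * theta_term 0 0 (2 * \<tau>) (2 * y) q))"
  proof (rule infsum_reindex_bij_witness[where
        i = "\<lambda>(p, q). (p + q, p - q)" and j = "\<lambda>(m, n). ((m + n) div 2, (m - n) div 2)"])
    fix a assume "a \<in> evens"
    then obtain m n where a: "a = (m, n)" and "even (m + n)"
      by (auto simp: evens_def)
    then obtain k where k: "m + n = 2 * k" by (elim evenE)
    hence n: "n = 2 * k - m" by simp
    have j: "(m + n) div 2 = k" "(m - n) div 2 = m - k"
      unfolding n by simp_all
    show "(\<lambda>(p, q). (p + q, p - q)) ((\<lambda>(m, n). ((m + n) div 2, (m - n) div 2)) a) = a"
      by (simp add: a j) (simp add: n)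
    have "theta_term 1 0 (2 * \<tau>) (2 * x) k * theta_term 0 0 (2 * \<tau>) (2 * y) (m - k) =
          - (theta_term 1 1 \<tau> (x + y) m * theta_term 1 1 \<tau> (x - y) (2 * k - m))"
      unfolding theta_term_def exp_add [symmetric]
      by (rule exp_eq_minusI[of _ _ "- (k + 1)"]) (simp add: field_simps power2_eq_square)
    thus "(\<lambda>(p, q). - (theta_term 1 0 (2 * \<tau>) (2 * x) p * theta_term 0 0 (2 * \<tau>) (2 * y) q))
        ((\<lambda>(m, n). ((m + n) div 2, (m - n) div 2)) a) = h a"
      by (simp add: a j h_def) (simp add: n)
  qed (auto simp: evens_def)
  also have "\<dots> = - (theta 1 0 (2 * x) (2 * \<tau>) * theta 0 0 (2 * y) (2 * \<tau>))"
    using infsum_mult_infsum(2)[OF abs_summable(2,2), of 1 0 "2 * x" 0 0 "2 * y"]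
    by (simp add: theta_eq_infsum case_prod_unfold infsum_uminus)
  finally show ?thesis using prod by simp
qed

text \<open>
  By \<open>theta11_product\<close> every factor \<open>T (x + y) * T (x - y)\<close> is a 2-by-2 minor of one matrix whose columns
  are indexed by \<open>x, y, z, v\<close>, so this is the Pluecker relation between such minors.
\<close>
lemma theta11_three_term:
  assumes "Im \<tau> > 0"
  defines "T \<equiv> \<lambda>\<zeta>. theta 1 1 \<zeta> \<tau>"
  shows "T (x + y) * T (x - y) * (T (z + v) * T (z - v))
       + T (y + z) * T (y - z) * (T (x + v) * T (x - v))
       + T (z + x) * T (z - x) * (T (y + v) * T (y - v)) = 0"
  unfolding T_def theta11_product[OF assms(1)] by algebra

text \<open>
  This is the case of three equal arguments of the addition theorem for the Weierstrass zeta function,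
  with denominators cleared. It is the infinitesimal form of the three-term relation at \<open>v = z\<close>, where
  \<open>T (z - v)\<close> vanishes to first order and its derivative brings in \<open>T' 0\<close>.
\<close>
lemma theta11_triple:
  assumes "Im \<tau> > 0"
  defines "T \<equiv> \<lambda>\<zeta>. theta 1 1 \<zeta> \<tau>"
  shows "3 * deriv T u * T u ^ 2 * T (3 * u) - deriv T (3 * u) * T u ^ 3 = deriv T 0 * T (2 * u) ^ 3"
proof -
  have T0: "T 0 = 0" and Tminus: "T (- z) = - T z" for z
    by (simp_all add: T_def theta11_0 theta11_minus)
  have D [derivative_intros]: "((\<lambda>x. T (f x)) has_field_derivative deriv T (f z) * f') (at z)"
    if "(f has_field_derivative f') (at z)" for f f' z
    using DERIV_chain2[OF theta_has_field_derivative[OF assms(1), of 1 1 "f z"] that] by (simp add: T_def)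
  \<comment> \<open>The points \<open>x = 2u\<close>, \<open>y = 0\<close>, \<open>z = u\<close> make every argument at \<open>v = u\<close> one of \<open>0\<close>, \<open>\<plusminus> u\<close>, \<open>\<plusminus> 2u\<close>, \<open>3u\<close>.\<close>
  define K where "K = (\<lambda>v. T (2*u) ^ 2 * (T (u + v) * T (u - v))
      - T u ^ 2 * (T (2*u + v) * T (2*u - v)) + T (3*u) * T u * T v ^ 2)"
  have "K v = 0" for v
    using theta11_three_term[OF assms(1), of "2*u" 0 u v]
    by (simp add: K_def T_def theta11_minus power2_eq_square algebra_simps)
  hence "K = (\<lambda>_. 0)" by blast
  hence "(K has_field_derivative 0) (at u)" by simp
  moreover have "(K has_field_derivative
      T (2*u) ^ 2 * (deriv T (2*u) * T 0 - T (2*u) * deriv T 0)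
      - T u ^ 2 * (deriv T (3*u) * T u - T (3*u) * deriv T u) + T (3*u) * T u * (2 * T u * deriv T u)) (at u)"
    unfolding K_def
    by ((rule derivative_eq_intros refl | simp)+, simp add: algebra_simps)
  ultimately show ?thesis
    using DERIV_unique T0 by (fastforce simp: algebra_simps power2_eq_square power3_eq_cube)
qed

section \<open>Nonvanishing at real torsion points\<close>

text \<open>
  By \<open>theta11_product\<close> the vanishing of \<open>T w ^ 2\<close> says that the coefficient vectors of \<open>w\<close> and of \<open>0\<close> are
  parallel. The second vector is nonzero, as otherwise \<open>T x ^ 2\<close> would vanish for all \<open>x\<close>.
\<close>
lemma theta11_proportional_to_square:
  assumes \<tau>: "Im \<tau> > 0" and w: "theta 1 1 w \<tau> = 0"
  obtains c where "\<And>x. theta 1 1 (x + w) \<tau> * theta 1 1 (x - w) \<tau> = c * theta 1 1 x \<tau> ^ 2"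
proof -
  define even_sum where "even_sum = (\<lambda>x. theta 0 0 (2 * x) (2 * \<tau>))"
  define odd_sum where "odd_sum = (\<lambda>x. theta 1 0 (2 * x) (2 * \<tau>))"
  have prod: "theta 1 1 (x + y) \<tau> * theta 1 1 (x - y) \<tau> = even_sum x * odd_sum y - odd_sum x * even_sum y" for x y
    unfolding even_sum_def odd_sum_def by (rule theta11_product[OF \<tau>])
  have square: "theta 1 1 x \<tau> ^ 2 = even_sum x * odd_sum 0 - odd_sum x * even_sum 0" for x
    using prod[of x 0] by (simp add: power2_eq_square)
  have parallel: "even_sum w * odd_sum 0 = odd_sum w * even_sum 0"
    using square[of w] w by simp
  have "even_sum 0 \<noteq> 0 \<or> odd_sum 0 \<noteq> 0"
    using theta_not_identically_zero[OF \<tau>, of 1 1] square by fastforce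
  thus ?thesis
  proof
    assume "even_sum 0 \<noteq> 0"
    moreover have *: "even_sum 0 * (theta 1 1 (x + w) \<tau> * theta 1 1 (x - w) \<tau>) = even_sum w * theta 1 1 x \<tau> ^ 2" for x
      unfolding prod square using parallel by algebra
    ultimately show ?thesis
      by (intro that[of "even_sum w / even_sum 0"]) (use * in \<open>simp add: field_simps\<close>)
  next
    assume "odd_sum 0 \<noteq> 0"
    moreover have *: "odd_sum 0 * (theta 1 1 (x + w) \<tau> * theta 1 1 (x - w) \<tau>) = odd_sum w * theta 1 1 x \<tau> ^ 2" for x
      unfolding prod square using parallel by algebra
    ultimately show ?thesis
      by (intro that[of "odd_sum w / odd_sum 0"]) (use * in \<open>simp add: field_simps\<close>)
  qed
qed

text \<open>
  Suppose \<open>T w = 0\<close>. By the previous lemma the values \<open>T (x + k w)\<close> satisfy a recurrence that makes the quotient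
  of consecutive ones a geometric progression in \<open>k\<close>. After \<open>N\<close> steps \<open>T\<close> returns to itself up to sign, so
  \<open>F x = T (x + w) / T x\<close> has a constant power. Hence \<open>F\<close> takes finitely many values, and it is
  constant off the zeros of the functions \<open>T (x + k w)\<close>, a countable set with connected complement. But
  quasi-periodicity gives \<open>F (x + \<tau>) = exp (- 2 \<pi> \<i> w) F x\<close>, which forces \<open>w\<close> to be an integer.
\<close>
lemma theta11_torsion_nonzero:
  fixes w :: complex
  assumes \<tau>: "Im \<tau> > 0" and N: "N > 0" "of_nat N * w \<in> \<int>" and w: "w \<notin> \<int>"
  shows "theta 1 1 w \<tau> \<noteq> 0"
proof
  define T where "T = (\<lambda>x. theta 1 1 x \<tau>)"
  assume "theta 1 1 w \<tau> = 0"
  then obtain c where c: "T (x + w) * T (x - w) = c * T x ^ 2" for x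
    using theta11_proportional_to_square[OF \<tau>] unfolding T_def by blast
  define F where "F = (\<lambda>x. T (x + w) / T x)"
  define Z where "Z = (\<Union>k::nat. {x. T (x + of_nat k * w) = 0})"
  have hol: "(\<lambda>x. T (x + a)) holomorphic_on A" for a A
    unfolding T_def
    by (rule holomorphic_on_compose[OF _ theta_holomorphic[OF \<tau>], unfolded o_def])
       (intro holomorphic_intros)
  have "countable Z"
    unfolding Z_def
  proof (intro countable_UN)
    fix k :: nat
    show "countable {x. T (x + of_nat k * w) = 0}"
    proof (rule ccontr)
      assume "uncountable {x. T (x + of_nat k * w) = 0}"
      hence "(\<lambda>x. T (x + of_nat k * w)) = (\<lambda>_. 0)"
        by (intro holomorphic_countable_equal_UNIV hol) auto
      hence "T (\<zeta> - of_nat k * w + of_nat k * w) = 0" for \<zeta>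
        by (rule fun_cong)
      thus False
        using theta_not_identically_zero[OF \<tau>, of 1 1] by (simp add: T_def)
    qed
  qed auto
  hence conn: "connected (- Z)"
    by (intro path_connected_imp_connected path_connected_complement_countable) auto
  have nz: "T (x + of_nat k * w) \<noteq> 0" if "x \<in> - Z" for x k
    using that by (auto simp: Z_def)
  have step: "T (x + of_nat (Suc k) * w) = T (x + of_nat k * w) * (F x * c ^ k)" if x: "x \<in> - Z" for x k
  proof (induction k)
    case 0
    thus ?case using nz[OF x, of 0] by (simp add: F_def)
  next
    case (Suc k)
    have "T (x + of_nat (Suc (Suc k)) * w) * T (x + of_nat k * w) = c * T (x + of_nat (Suc k) * w) ^ 2"
      using c[of "x + of_nat (Suc k) * w"] by (simp add: algebra_simps)
    also have "\<dots> = T (x + of_nat (Suc k) * w) * (c * T (x + of_nat (Suc k) * w))"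
      by (simp add: power2_eq_square)
    also have "c * T (x + of_nat (Suc k) * w) = F x * c ^ Suc k * T (x + of_nat k * w)"
      by (subst Suc.IH) (simp add: mult_ac)
    finally show ?case using nz[OF x, of k] by simp
  qed
  have iter: "T (x + of_nat k * w) = T x * (F x ^ k * c ^ (\<Sum>j<k. j))" if x: "x \<in> - Z" for x k
  proof (induction k)
    case (Suc k)
    show ?case unfolding step[OF x] Suc.IH by (simp add: power_add)
  qed auto
  obtain m where m: "of_nat N * w = of_int m" using N by (elim Ints_cases)
  define d where "d = c ^ (2 * (\<Sum>j<N. j))"
  \<comment> \<open>Squaring removes the sign \<open>(-1) ^ m\<close> by which \<open>T (x + m)\<close> differs from \<open>T x\<close>.\<close>
  have root: "F x ^ (2 * N) = inverse d" if x: "x \<in> - Z" for x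
  proof -
    have "T x ^ 2 = T (x + of_nat N * w) ^ 2"
      unfolding m T_def by (simp add: theta11_add_int_squared)
    also have "\<dots> = T x ^ 2 * (F x ^ (2 * N) * d)"
      unfolding iter[OF x] d_def by (simp add: power_mult_distrib mult.commute flip: power_mult)
    finally have "F x ^ (2 * N) * d = 1"
      using nz[OF x, of 0] by simp
    thus ?thesis by (simp add: inverse_unique mult.commute)
  qed
  have "F constant_on (- Z)"
  proof (rule continuous_finite_range_constant[OF conn])
    show "continuous_on (- Z) F"
      unfolding F_def using nz[of _ 0] hol[of w "- Z"] hol[of 0 "- Z"]
      by (intro continuous_on_divide holomorphic_on_imp_continuous_on) auto
    have "finite {z. z ^ (2 * N) = inverse d}"
      using N by (intro finite_nth_roots) auto
    thus "finite (F ` (- Z))"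
      by (rule rev_finite_subset) (use root in auto)
  qed
  then obtain C where C: "F x = C" if "x \<in> - Z" for x
    by (auto simp: constant_on_def)
  define \<mu> where "\<mu> = (\<lambda>x. exp (- (of_real pi * \<i> * (\<tau> + 2 * x + 1))))"
  have period: "T (x + \<tau>) = \<mu> x * T x" for x
    using theta_add_period[of 1 1 x \<tau>] by (simp add: T_def \<mu>_def)
  have "- Z \<noteq> {}"
    using \<open>countable Z\<close> uncountable_UNIV_complex by (metis Compl_empty_eq double_complement)
  then obtain x where x: "x \<in> - Z" by blast
  have "T (x + \<tau> + of_nat k * w) \<noteq> 0" for k
    using period[of "x + of_nat k * w"] nz[OF x, of k] by (simp add: \<mu>_def add_ac)
  hence "x + \<tau> \<in> - Z"
    by (simp add: Z_def)
  hence "F (x + \<tau>) = F x" using C x by simp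
  moreover have "F (x + \<tau>) = exp (- (2 * of_real pi * \<i> * w)) * F x"
  proof -
    have "T (x + \<tau> + w) = \<mu> (x + w) * T (x + w)"
      using period[of "x + w"] by (simp add: add_ac)
    moreover have "\<mu> (x + w) = exp (- (2 * of_real pi * \<i> * w)) * \<mu> x"
      by (simp add: \<mu>_def exp_add [symmetric] algebra_simps)
    moreover have "\<mu> x \<noteq> 0" by (simp add: \<mu>_def)
    ultimately show ?thesis by (simp add: F_def period)
  qed
  moreover have "F x \<noteq> 0"
    using nz[OF x, of 0] nz[OF x, of 1] by (simp add: F_def)
  ultimately have "exp (- (2 * of_real pi * \<i> * w)) = 1" by simp
  then obtain n :: int where n: "Im w = 0" "- (2 * pi * Re w) = of_int (2 * n) * pi"
    by (auto simp: exp_eq_1)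
  hence "pi * Re w = pi * of_int (- n)"
    by (simp add: mult_ac)
  hence "Re w = of_int (- n)"
    by (subst (asm) mult_cancel_left) simp
  hence "w = of_int (- n)"
    using n(1) by (simp add: complex_eq_iff)
  thus False using w Ints_of_int by metis
qed

section \<open>The constants at the fifths\<close>

lemma theta_1_as_theta11:
  "theta 1 \<epsilon>' \<zeta> \<tau> = theta 1 1 (\<zeta> + of_real ((\<epsilon>' - 1) / 2)) \<tau>"
  by (simp add: theta_def field_simps)

theorem theorem4p7:
  fixes \<tau> :: complex
  assumes "Im \<tau> > 0"
  shows "theta_deriv 1 (1/5) \<tau> / theta_const 1 (1/5) \<tau> =
           theta_deriv 1 1 \<tau> *
             ((theta_const 1 (1/5) \<tau> ^ 5 - 3 * theta_const 1 (3/5) \<tau> ^ 5) /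
              (10 * theta_const 1 (1/5) \<tau> ^ 3 * theta_const 1 (3/5) \<tau> ^ 3))
       \<and> theta_deriv 1 (3/5) \<tau> / theta_const 1 (3/5) \<tau> =
           theta_deriv 1 1 \<tau> *
             ((3 * theta_const 1 (1/5) \<tau> ^ 5 + theta_const 1 (3/5) \<tau> ^ 5) /
              (10 * theta_const 1 (1/5) \<tau> ^ 3 * theta_const 1 (3/5) \<tau> ^ 3))"
proof -
  define T where "T = (\<lambda>x. theta 1 1 x \<tau>)"
  define a a' where "a = T (1/5)" and "a' = deriv T (1/5)"
  define b b' where "b = T (2/5)" and "b' = deriv T (2/5)"
  define t' where "t' = deriv T 0"
  have T_minus: "T (- x) = - T x" and T_shift: "T (x + 1) = - T x" for x
    by (simp_all add: T_def theta11_minus theta11_add_1)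
  have D: "(T has_field_derivative deriv T x) (at x)" for x
    unfolding T_def by (rule theta_has_field_derivative[OF assms])
  have deriv_minus: "deriv T (- x) = deriv T x" for x
  proof -
    have "((\<lambda>y. - T (- y)) has_field_derivative deriv T (- x)) (at x)"
      by (rule derivative_eq_intros DERIV_chain2[OF D] refl | simp)+
    thus ?thesis by (simp add: T_minus DERIV_imp_deriv)
  qed
  have deriv_shift: "deriv T (x + 1) = - deriv T x" for x
  proof -
    have "((\<lambda>y. - T (y + 1)) has_field_derivative - deriv T (x + 1)) (at x)"
      by (rule derivative_eq_intros DERIV_chain2[OF D] refl | simp)+
    hence "deriv T x = - deriv T (x + 1)" by (simp add: T_shift DERIV_imp_deriv)
    thus ?thesis by simp
  qed
  \<comment> \<open>Reflection and translation by 1 carry each fifth to \<open>1/5\<close> or \<open>2/5\<close>; this closes the system of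
    triplication relations at \<open>u = 1/5\<close> and \<open>u = 2/5\<close>.\<close>
  have vals: "T (3/5) = b" "deriv T (3/5) = - b'" "T (4/5) = a" "T (6/5) = - a" "deriv T (6/5) = - a'"
    using T_shift[of "-2/5"] deriv_shift[of "-2/5"] T_shift[of "-1/5"] T_shift[of "1/5"] deriv_shift[of "1/5"]
      T_minus[of "2/5"] deriv_minus[of "2/5"] T_minus[of "1/5"]
    by (simp_all add: a_def b_def a'_def b'_def)
  have triple: "3 * deriv T u * T u ^ 2 * T (3 * u) - deriv T (3 * u) * T u ^ 3 = deriv T 0 * T (2 * u) ^ 3" for u
    unfolding T_def by (rule theta11_triple[OF assms])
  have r1: "3 * a' * a^2 * b + b' * a^3 = t' * b^3"
    using triple[of "1/5"] vals
    by (simp add: a_def a'_def b_def b'_def t'_def)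
  have r2: "a' * b^3 - 3 * b' * b^2 * a = t' * a^3"
    using triple[of "2/5"] vals
    by (simp add: a_def a'_def b_def b'_def t'_def)
  have nz: "a \<noteq> 0" "b \<noteq> 0"
    using theta11_torsion_nonzero[OF assms, of 5 "1/5"] theta11_torsion_nonzero[OF assms, of 5 "2/5"]
    by (auto simp: a_def b_def T_def)
  have shift: "theta_const 1 \<epsilon>' \<tau> = T (of_real ((\<epsilon>' - 1) / 2))"
    "theta_deriv 1 \<epsilon>' \<tau> = deriv T (of_real ((\<epsilon>' - 1) / 2))" for \<epsilon>'
  proof -
    show "theta_const 1 \<epsilon>' \<tau> = T (of_real ((\<epsilon>' - 1) / 2))"
      unfolding theta_const_def T_def by (subst theta_1_as_theta11) simp
    have "((\<lambda>\<zeta>. T (\<zeta> + of_real ((\<epsilon>' - 1) / 2))) has_field_derivative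
             deriv T (of_real ((\<epsilon>' - 1) / 2))) (at 0)"
      unfolding DERIV_shift [symmetric] by (simp add: D)
    thus "theta_deriv 1 \<epsilon>' \<tau> = deriv T (of_real ((\<epsilon>' - 1) / 2))"
      unfolding theta_deriv_def theta_1_as_theta11[of \<epsilon>'] T_def by (rule DERIV_imp_deriv)
  qed
  have const_eqs: "theta_const 1 (1/5) \<tau> = - b" "theta_const 1 (3/5) \<tau> = - a"
    "theta_deriv 1 (1/5) \<tau> = b'" "theta_deriv 1 (3/5) \<tau> = a'" "theta_deriv 1 1 \<tau> = t'"
    using T_minus[of "2/5"] T_minus[of "1/5"] deriv_minus[of "2/5"] deriv_minus[of "1/5"]
    by (simp_all add: shift a_def a'_def b_def b'_def t'_def)
  \<comment> \<open>Elimination of \<open>b'\<close> and of \<open>a'\<close> from the linear system \<open>r1\<close>, \<open>r2\<close>, whose determinant is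
    \<open>- 10 * a^3 * b^3\<close>.\<close>
  have "10 * a' * a^2 * b^3 = t' * (3 * b^5 + a^5)"
    using r1 r2 by algebra
  moreover have "10 * b' * a^3 * b^2 = t' * (b^5 - 3 * a^5)"
    using r1 r2 by algebra
  ultimately show ?thesis
    unfolding const_eqs using nz by (simp add: field_simps eval_nat_numeral)
qed

end
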